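(* Let $A=(A_0,A_1,s,t,e,\circ,\bullet)$ and $A'=(A_0',A_1',s',t',e',\circ',\bullet')$ be $2$-algebras, let $F=(F_1,F_0)$ and $G=(G_1,G_0)$ be $2$-algebra morphisms $A\to A'$, and let $\delta:A_0\to A_1'$ be a homotopy connecting $F$ to $G$. Then the map $$h:A_0\longrightarrow \ker s',\qquad h(x)=\delta(x)-e'\big(s'(\delta(x))\big),$$ is a homotopy of the corresponding crossed module morphisms; that is, $(F_0,h)$ is a homotopy connecting the crossed module morphism $\Gamma(F)$ to the crossed module morphism $\Gamma(G)$.
   Context: Let $k$ be a commutative ring with identity. "Module" means $k$-module; "algebra" means commutative associative $k$-algebra, not necessarily with identity unless stated. Morphisms between algebras assumed to have an identity preserve the identity. **2-modules.** A $2$-module is an internal category in the category of $k$-modules: modules $M_0$ (objects) and $M_1$ (morphisms), and $k$-linear maps $s,t:M_1\to M_0$, $e:M_0\to M_1$ and $\circ: M_1\times_{M_0}M_1=\{(a,b): t(a)=s(b)\}\to M_1$, $(a,b)\mapsto a\circ b$, such that $se=te=\mathrm{id}_{M_0}$, $s(a\circ b)=s(a)$, $t(a\circ b)=t(b)$, $\circ$ is associative, and $e(s(a))\circ a=a=a\circ e(t(a))$ for all $a\in M_1$. **2-algebras.** A $2$-algebra (commutative strict $2$-algebra) $A=(A_0,A_1,s,t,e,\circ,\bullet)$ is a $2$-module $(A_0,A_1,s,t,e,\circ)$ with a functor $\bullet:A\times A\to A$, $k$-bilinear on objects and on morphisms, which is strictly associative, commutative and unital with an identity object $1\in A_0$ (identity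 on morphisms $e(1)$). Functoriality means that $s,t,e$ are compatible with $\bullet$ and $(f_1\bullet g_1)\circ(f_2\bullet g_2)=(f_1\circ f_2)\bullet(g_1\circ g_2)$ whenever $f_1\circ f_2$ and $g_1\circ g_2$ are defined. Thus $A_0,A_1$ are commutative algebras with identity under $\bullet$ and $s,t,e$ are algebra morphisms. A morphism of $2$-algebras $F=(F_1,F_0):A\to A'$ is a pair of identity-preserving $k$-algebra morphisms $F_1:A_1\to A_1'$, $F_0:A_0\to A_0'$ with $s'F_1=F_0s$, $t'F_1=F_0t$, $e'F_0=F_1e$ and $F_1(a\circ b)=F_1(a)\circ'F_1(b)$ whenever $a\circ b$ is defined. **Homotopy of 2-algebra morphisms.** For $2$-algebra morphisms $F,G:A\to A'$, a homotopy connecting $F$ to $G$ is a $k$-algebra morphism $\delta:A_0\to A_1'$ with $s'\delta=F_0$, $t'\delta=G_0$, and $F_1(a)\circ'\delta(t(a))=\delta(s(a))\circ'G_1(a)$ for all $a\in A_1$. **Crossed modules.** A crossed module of commutative $k$-algebras $(C,R,\partial)$ consists of a commutative $k$-algebra $R$ with identity, a commutative $R$-algebra $C$ (not necessarily with identity), with action written $r\blacktriangleright c$, and a $k$-algebra morphism $\partial:C\to R$ such that $\partial(r\blacktriangleright c)=r\,\partial(c)$ and $\partial(c)\blacktriangleright c'=cc'$ for all $r\in R$, $c,c'\in C$. A morphism $(f_1,f_0):(C,R,\partial)\to(C',R',\partial')$ is a pair of $k$-algebra morphisms $f_1:C\to C'$, $f_0:R\to R'$ with $\partial'f_1=f_0\partial$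 and $f_1(r\blacktriangleright c)=f_0(r)\blacktriangleright f_1(c)$. **Homotopy of crossed module morphisms.** Given an algebra morphism $f_0:R\to R'$, an $f_0$-derivation is a $k$-linear map $h:R\to C'$ with $h(rr')=f_0(r)\blacktriangleright h(r')+f_0(r')\blacktriangleright h(r)+h(r)h(r')$ for all $r,r'\in R$. For crossed module morphisms $f=(f_1,f_0)$ and $g=(g_1,g_0)$ from $(C,R,\partial)$ to $(C',R',\partial')$, one says that $(f_0,h)$ is a homotopy connecting $f$ to $g$ if $h$ is an $f_0$-derivation, $g_0(r)=f_0(r)+\partial'(h(r))$ for all $r\in R$, and $g_1(c)=f_1(c)+h(\partial(c))$ for all $c\in C$. **The functor $\Gamma$ from 2-algebras to crossed modules.** $\Gamma(A)=(\ker s,A_0,\partial)$, where $\ker s\subseteq A_1$ is the kernel of $s$ with multiplication $\bullet$, $\partial=t|_{\ker s}$, and $x\blacktriangleright q=e(x)\bullet q$ for $x\in A_0$, $q\in\ker s$. For a morphism $F=(F_1,F_0):A\to A'$, $\Gamma(F)=(F_1|_{\ker s},F_0):\Gamma(A)\to\Gamma(A')$. *)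

theory Defs
  imports "HOL-Algebra.Module" "HOL-Algebra.AbelCoset"
begin

section \<open>Commutative algebras and their morphisms\<close>

text \<open>
  The locale \<^locale>\<open>algebra\<close> of the library describes commutative algebras with identity. The
  following one describes commutative algebras that need not have an identity; they are carried by
  the same records, but their field \<open>one\<close> is meaningless and never used.
\<close>

locale nonunital_algebra = module k C for k (structure) and C (structure) +
  assumes mult_closed:
      "\<lbrakk>x \<in> carrier C; y \<in> carrier C\<rbrakk> \<Longrightarrow> x \<otimes>\<^bsub>C\<^esub> y \<in> carrier C"
    and mult_assoc:
      "\<lbrakk>x \<in> carrier C; y \<in> carrier C; z \<in> carrier C\<rbrakk>
        \<Longrightarrow> (x \<otimes>\<^bsub>C\<^esub> y) \<otimes>\<^bsub>C\<^esub> z = x \<otimes>\<^bsub>C\<^esub> (y \<otimes>\<^bsub>C\<^esub> z)"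
    and mult_comm:
      "\<lbrakk>x \<in> carrier C; y \<in> carrier C\<rbrakk> \<Longrightarrow> x \<otimes>\<^bsub>C\<^esub> y = y \<otimes>\<^bsub>C\<^esub> x"
    and mult_add:
      "\<lbrakk>x \<in> carrier C; y \<in> carrier C; z \<in> carrier C\<rbrakk>
        \<Longrightarrow> (x \<oplus>\<^bsub>C\<^esub> y) \<otimes>\<^bsub>C\<^esub> z = x \<otimes>\<^bsub>C\<^esub> z \<oplus>\<^bsub>C\<^esub> y \<otimes>\<^bsub>C\<^esub> z"
    and mult_smult:
      "\<lbrakk>c \<in> carrier k; x \<in> carrier C; y \<in> carrier C\<rbrakk>
        \<Longrightarrow> (c \<odot>\<^bsub>C\<^esub> x) \<otimes>\<^bsub>C\<^esub> y = c \<odot>\<^bsub>C\<^esub> (x \<otimes>\<^bsub>C\<^esub> y)"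

definition linear_maps ::
    "('k, 'z) ring_scheme \<Rightarrow> ('k, 'a) module \<Rightarrow> ('k, 'b) module \<Rightarrow> ('a \<Rightarrow> 'b) set" where
  "linear_maps k M N =
    {f \<in> carrier M \<rightarrow> carrier N.
      (\<forall>x\<in>carrier M. \<forall>y\<in>carrier M. f (x \<oplus>\<^bsub>M\<^esub> y) = f x \<oplus>\<^bsub>N\<^esub> f y) \<and>
      (\<forall>c\<in>carrier k. \<forall>x\<in>carrier M. f (c \<odot>\<^bsub>M\<^esub> x) = c \<odot>\<^bsub>N\<^esub> f x)}"

definition nonunital_alg_hom ::
    "('k, 'z) ring_scheme \<Rightarrow> ('k, 'a) module \<Rightarrow> ('k, 'b) module \<Rightarrow> ('a \<Rightarrow> 'b) set" where
  "nonunital_alg_hom k A B =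
    {f \<in> linear_maps k A B.
      \<forall>x\<in>carrier A. \<forall>y\<in>carrier A. f (x \<otimes>\<^bsub>A\<^esub> y) = f x \<otimes>\<^bsub>B\<^esub> f y}"

definition alg_hom ::
    "('k, 'z) ring_scheme \<Rightarrow> ('k, 'a) module \<Rightarrow> ('k, 'b) module \<Rightarrow> ('a \<Rightarrow> 'b) set" where
  "alg_hom k A B = {f \<in> nonunital_alg_hom k A B. f \<one>\<^bsub>A\<^esub> = \<one>\<^bsub>B\<^esub>}"


section \<open>2-modules and 2-algebras\<close>

text \<open>
  One record serves for 2-modules and for 2-algebras: the operation \<open>\<bullet>\<close> and its identity are
  the fields \<open>mult\<close> and \<open>one\<close> of the records of objects and of morphisms, which a 2-module ignores.
  Composition is in diagrammatic order: \<open>comp2 A a b\<close> is \<open>a \<circ> b\<close>, meaningful if \<open>t a = s b\<close>.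
\<close>

record ('k, 'a, 'b) two_struct =
  Obj :: "('k, 'a) module"
  Mor :: "('k, 'b) module"
  src :: "'b \<Rightarrow> 'a"
  tgt :: "'b \<Rightarrow> 'a"
  ident :: "'a \<Rightarrow> 'b"
  comp2 :: "'b \<Rightarrow> 'b \<Rightarrow> 'b"

text \<open>The axioms \<open>comp_add\<close> and \<open>comp_smult\<close> are the linearity of composition on the fibre product
  of \<open>Mor A\<close> with itself over \<open>Obj A\<close>.\<close>

locale two_module = Obj: module k "Obj A" + Mor: module k "Mor A"
  for k :: "('k, 'z) ring_scheme" (structure) and A :: "('k, 'a, 'b) two_struct" +
  assumes src_linear: "src A \<in> linear_maps k (Mor A) (Obj A)"
    and tgt_linear: "tgt A \<in> linear_maps k (Mor A) (Obj A)"
    and ident_linear: "ident A \<in> linear_maps k (Obj A) (Mor A)"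
    and comp_closed:
      "\<lbrakk>a \<in> carrier (Mor A); b \<in> carrier (Mor A); tgt A a = src A b\<rbrakk>
        \<Longrightarrow> comp2 A a b \<in> carrier (Mor A)"
    and comp_add:
      "\<lbrakk>a \<in> carrier (Mor A); b \<in> carrier (Mor A); tgt A a = src A b;
        a' \<in> carrier (Mor A); b' \<in> carrier (Mor A); tgt A a' = src A b'\<rbrakk>
        \<Longrightarrow> comp2 A (a \<oplus>\<^bsub>Mor A\<^esub> a') (b \<oplus>\<^bsub>Mor A\<^esub> b') = comp2 A a b \<oplus>\<^bsub>Mor A\<^esub> comp2 A a' b'"
    and comp_smult:
      "\<lbrakk>\<kappa> \<in> carrier k; a \<in> carrier (Mor A); b \<in> carrier (Mor A); tgt A a = src A b\<rbrakk>
        \<Longrightarrow> comp2 A (\<kappa> \<odot>\<^bsub>Mor A\<^esub> a) (\<kappa> \<odot>\<^bsub>Mor A\<^esub> b) = \<kappa> \<odot>\<^bsub>Mor A\<^esub> comp2 A a b"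
    and src_ident: "x \<in> carrier (Obj A) \<Longrightarrow> src A (ident A x) = x"
    and tgt_ident: "x \<in> carrier (Obj A) \<Longrightarrow> tgt A (ident A x) = x"
    and src_comp:
      "\<lbrakk>a \<in> carrier (Mor A); b \<in> carrier (Mor A); tgt A a = src A b\<rbrakk>
        \<Longrightarrow> src A (comp2 A a b) = src A a"
    and tgt_comp:
      "\<lbrakk>a \<in> carrier (Mor A); b \<in> carrier (Mor A); tgt A a = src A b\<rbrakk>
        \<Longrightarrow> tgt A (comp2 A a b) = tgt A b"
    and comp_assoc:
      "\<lbrakk>a \<in> carrier (Mor A); b \<in> carrier (Mor A); c \<in> carrier (Mor A);
        tgt A a = src A b; tgt A b = src A c\<rbrakk>
        \<Longrightarrow> comp2 A (comp2 A a b) c = comp2 A a (comp2 A b c)"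
    and ident_comp: "a \<in> carrier (Mor A) \<Longrightarrow> comp2 A (ident A (src A a)) a = a"
    and comp_ident: "a \<in> carrier (Mor A) \<Longrightarrow> comp2 A a (ident A (tgt A a)) = a"

text \<open>The two \<^locale>\<open>algebra\<close> imports say that \<open>\<bullet>\<close> is bilinear, associative, commutative and unital
  on objects and on morphisms; the assumptions say that it is a functor and that the unit of
  \<open>Mor A\<close> is the identity morphism of the unit object.\<close>

locale two_algebra = two_module k A + Obj: algebra k "Obj A" + Mor: algebra k "Mor A"
  for k :: "('k, 'z) ring_scheme" (structure) and A :: "('k, 'a, 'b) two_struct" +
  assumes src_mult:
      "\<lbrakk>a \<in> carrier (Mor A); b \<in> carrier (Mor A)\<rbrakk>
        \<Longrightarrow> src A (a \<otimes>\<^bsub>Mor A\<^esub> b) = src A a \<otimes>\<^bsub>Obj A\<^esub> src A b"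
    and tgt_mult:
      "\<lbrakk>a \<in> carrier (Mor A); b \<in> carrier (Mor A)\<rbrakk>
        \<Longrightarrow> tgt A (a \<otimes>\<^bsub>Mor A\<^esub> b) = tgt A a \<otimes>\<^bsub>Obj A\<^esub> tgt A b"
    and ident_mult:
      "\<lbrakk>x \<in> carrier (Obj A); y \<in> carrier (Obj A)\<rbrakk>
        \<Longrightarrow> ident A (x \<otimes>\<^bsub>Obj A\<^esub> y) = ident A x \<otimes>\<^bsub>Mor A\<^esub> ident A y"
    and one_Mor: "\<one>\<^bsub>Mor A\<^esub> = ident A \<one>\<^bsub>Obj A\<^esub>"
    and interchange:
      "\<lbrakk>f1 \<in> carrier (Mor A); f2 \<in> carrier (Mor A); tgt A f1 = src A f2;
        g1 \<in> carrier (Mor A); g2 \<in> carrier (Mor A); tgt A g1 = src A g2\<rbrakk>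
        \<Longrightarrow> comp2 A (f1 \<otimes>\<^bsub>Mor A\<^esub> g1) (f2 \<otimes>\<^bsub>Mor A\<^esub> g2)
          = comp2 A f1 f2 \<otimes>\<^bsub>Mor A\<^esub> comp2 A g1 g2"

text \<open>Morphisms are pairs with the component on morphisms first, \<open>F = (F\<^sub>1, F\<^sub>0)\<close>.\<close>

definition two_algebra_hom ::
    "('k, 'z) ring_scheme \<Rightarrow> ('k, 'a, 'b) two_struct \<Rightarrow> ('k, 'c, 'd) two_struct
      \<Rightarrow> ('b \<Rightarrow> 'd) \<times> ('a \<Rightarrow> 'c) \<Rightarrow> bool" where
  "two_algebra_hom k A A' = (\<lambda>(F1, F0).
    two_algebra k A \<and> two_algebra k A' \<and>
    F1 \<in> alg_hom k (Mor A) (Mor A') \<and>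
    F0 \<in> alg_hom k (Obj A) (Obj A') \<and>
    (\<forall>a\<in>carrier (Mor A). src A' (F1 a) = F0 (src A a)) \<and>
    (\<forall>a\<in>carrier (Mor A). tgt A' (F1 a) = F0 (tgt A a)) \<and>
    (\<forall>x\<in>carrier (Obj A). ident A' (F0 x) = F1 (ident A x)) \<and>
    (\<forall>a\<in>carrier (Mor A). \<forall>b\<in>carrier (Mor A). tgt A a = src A b \<longrightarrow>
      F1 (comp2 A a b) = comp2 A' (F1 a) (F1 b)))"

definition two_algebra_homotopy ::
    "('k, 'z) ring_scheme \<Rightarrow> ('k, 'a, 'b) two_struct \<Rightarrow> ('k, 'c, 'd) two_struct
      \<Rightarrow> ('b \<Rightarrow> 'd) \<times> ('a \<Rightarrow> 'c) \<Rightarrow> ('b \<Rightarrow> 'd) \<times> ('a \<Rightarrow> 'c) \<Rightarrow> ('a \<Rightarrow> 'd) \<Rightarrow> bool" where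
  "two_algebra_homotopy k A A' = (\<lambda>(F1, F0) (G1, G0) \<delta>.
    two_algebra_hom k A A' (F1, F0) \<and> two_algebra_hom k A A' (G1, G0) \<and>
    \<delta> \<in> alg_hom k (Obj A) (Mor A') \<and>
    (\<forall>x\<in>carrier (Obj A). src A' (\<delta> x) = F0 x) \<and>
    (\<forall>x\<in>carrier (Obj A). tgt A' (\<delta> x) = G0 x) \<and>
    (\<forall>a\<in>carrier (Mor A).
      comp2 A' (F1 a) (\<delta> (tgt A a)) = comp2 A' (\<delta> (src A a)) (G1 a)))"


section \<open>Crossed modules\<close>

record ('k, 'c, 'r) xmod =
  xtop :: "('k, 'c) module"
  xbase :: "('k, 'r) module"
  xbdry :: "'c \<Rightarrow> 'r"
  xact :: "'r \<Rightarrow> 'c \<Rightarrow> 'c"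

text \<open>The ring \<open>C\<close> of a crossed module \<open>(C, R, \<partial>)\<close>, with the action of \<open>R\<close> as scalar multiplication.\<close>

definition xtop_over_base :: "('k, 'c, 'r) xmod \<Rightarrow> ('r, 'c) module" where
  "xtop_over_base X =
    \<lparr>carrier = carrier (xtop X), mult = mult (xtop X), one = one (xtop X),
     zero = zero (xtop X), add = add (xtop X), smult = xact X\<rparr>"

text \<open>Here \<open>C\<close> is both a \<open>k\<close>-algebra and an \<open>R\<close>-algebra; \<open>act_smult\<close> says that its \<open>k\<close>-module
  structure is the one induced from its \<open>R\<close>-module structure.\<close>

locale crossed_module = Base: algebra k "xbase X" + Top: nonunital_algebra k "xtop X" +
    Act: nonunital_algebra "xbase X" "xtop_over_base X"
  for k :: "('k, 'z) ring_scheme" (structure) and X :: "('k, 'c, 'r) xmod" +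
  assumes act_smult:
      "\<lbrakk>\<kappa> \<in> carrier k; r \<in> carrier (xbase X); c \<in> carrier (xtop X)\<rbrakk>
        \<Longrightarrow> xact X (\<kappa> \<odot>\<^bsub>xbase X\<^esub> r) c = \<kappa> \<odot>\<^bsub>xtop X\<^esub> xact X r c"
    and bdry_hom: "xbdry X \<in> nonunital_alg_hom k (xtop X) (xbase X)"
    and bdry_act:
      "\<lbrakk>r \<in> carrier (xbase X); c \<in> carrier (xtop X)\<rbrakk>
        \<Longrightarrow> xbdry X (xact X r c) = r \<otimes>\<^bsub>xbase X\<^esub> xbdry X c"
    and peiffer:
      "\<lbrakk>c \<in> carrier (xtop X); c' \<in> carrier (xtop X)\<rbrakk>
        \<Longrightarrow> xact X (xbdry X c) c' = c \<otimes>\<^bsub>xtop X\<^esub> c'"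

definition xmod_hom ::
    "('k, 'z) ring_scheme \<Rightarrow> ('k, 'c, 'r) xmod \<Rightarrow> ('k, 'd, 's) xmod
      \<Rightarrow> ('c \<Rightarrow> 'd) \<times> ('r \<Rightarrow> 's) \<Rightarrow> bool" where
  "xmod_hom k X X' = (\<lambda>(f1, f0).
    crossed_module k X \<and> crossed_module k X' \<and>
    f1 \<in> nonunital_alg_hom k (xtop X) (xtop X') \<and>
    f0 \<in> alg_hom k (xbase X) (xbase X') \<and>
    (\<forall>c\<in>carrier (xtop X). xbdry X' (f1 c) = f0 (xbdry X c)) \<and>
    (\<forall>r\<in>carrier (xbase X). \<forall>c\<in>carrier (xtop X). f1 (xact X r c) = xact X' (f0 r) (f1 c)))"

definition xmod_derivation ::
    "('k, 'z) ring_scheme \<Rightarrow> ('k, 'r) module \<Rightarrow> ('k, 'd, 's) xmod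
      \<Rightarrow> ('r \<Rightarrow> 's) \<Rightarrow> ('r \<Rightarrow> 'd) \<Rightarrow> bool" where
  "xmod_derivation k R X' f0 h \<longleftrightarrow>
    f0 \<in> alg_hom k R (xbase X') \<and>
    h \<in> linear_maps k R (xtop X') \<and>
    (\<forall>r\<in>carrier R. \<forall>r'\<in>carrier R.
      h (r \<otimes>\<^bsub>R\<^esub> r') =
        xact X' (f0 r) (h r') \<oplus>\<^bsub>xtop X'\<^esub> xact X' (f0 r') (h r) \<oplus>\<^bsub>xtop X'\<^esub> h r \<otimes>\<^bsub>xtop X'\<^esub> h r')"

text \<open>The first component of a homotopy \<open>(\<phi>, h)\<close> connecting \<open>(f\<^sub>1, f\<^sub>0)\<close> to \<open>(g\<^sub>1, g\<^sub>0)\<close> is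
  \<open>f\<^sub>0\<close> itself.\<close>

definition xmod_homotopy ::
    "('k, 'z) ring_scheme \<Rightarrow> ('k, 'c, 'r) xmod \<Rightarrow> ('k, 'd, 's) xmod
      \<Rightarrow> ('c \<Rightarrow> 'd) \<times> ('r \<Rightarrow> 's) \<Rightarrow> ('c \<Rightarrow> 'd) \<times> ('r \<Rightarrow> 's)
      \<Rightarrow> ('r \<Rightarrow> 's) \<times> ('r \<Rightarrow> 'd) \<Rightarrow> bool" where
  "xmod_homotopy k X X' = (\<lambda>(f1, f0) (g1, g0) (\<phi>, h).
    xmod_hom k X X' (f1, f0) \<and> xmod_hom k X X' (g1, g0) \<and>
    (\<forall>r\<in>carrier (xbase X). \<phi> r = f0 r) \<and>
    xmod_derivation k (xbase X) X' f0 h \<and>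
    (\<forall>r\<in>carrier (xbase X). g0 r = f0 r \<oplus>\<^bsub>xbase X'\<^esub> xbdry X' (h r)) \<and>
    (\<forall>c\<in>carrier (xtop X). g1 c = f1 c \<oplus>\<^bsub>xtop X'\<^esub> h (xbdry X c)))"


section \<open>The functor from 2-algebras to crossed modules\<close>

definition ker_src :: "('k, 'a, 'b) two_struct \<Rightarrow> 'b set" where
  "ker_src A = a_kernel (Mor A) (Obj A) (src A)"

definition Gamma :: "('k, 'a, 'b) two_struct \<Rightarrow> ('k, 'b, 'a) xmod" where
  "Gamma A =
    \<lparr>xtop = (Mor A)\<lparr>carrier := ker_src A\<rparr>,
     xbase = Obj A,
     xbdry = restrict (tgt A) (ker_src A),
     xact = (\<lambda>x q. ident A x \<otimes>\<^bsub>Mor A\<^esub> q)\<rparr>"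

definition Gamma_hom ::
    "('k, 'a, 'b) two_struct \<Rightarrow> ('b \<Rightarrow> 'd) \<times> ('a \<Rightarrow> 'c) \<Rightarrow> ('b \<Rightarrow> 'd) \<times> ('a \<Rightarrow> 'c)" where
  "Gamma_hom A = (\<lambda>(F1, F0). (restrict F1 (ker_src A), F0))"

end

theory Submission
  imports Defs
begin

text \<open>
  Linearity forces the composition of a 2-module to be \<open>a \<circ> b = a + b - e (t a)\<close>. This turns the
  naturality square of \<open>\<delta>\<close> at a morphism \<open>c\<close> with source \<open>0\<close> into \<open>G\<^sub>1 c = F\<^sub>1 c + h (t c)\<close>. The
  derivation rule for \<open>h\<close> is the expansion of \<open>(e' F\<^sub>0 r + h r) (e' F\<^sub>0 r' + h r')\<close>, which equals
  \<open>\<delta> (r r')\<close>. The Peiffer identity for \<open>\<Gamma>(A)\<close> is the interchange law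
  \<open>(c \<circ> e (t c)) \<bullet> (0 \<circ> d) = (c \<bullet> 0) \<circ> (e (t c) \<bullet> d)\<close> for \<open>c\<close>, \<open>d\<close> in the kernel of \<open>s\<close>.
\<close>

section \<open>Linear maps between modules\<close>

lemma linear_mapsD:
  assumes "f \<in> linear_maps k M N"
  shows "x \<in> carrier M \<Longrightarrow> f x \<in> carrier N"
    and "\<lbrakk>x \<in> carrier M; y \<in> carrier M\<rbrakk> \<Longrightarrow> f (x \<oplus>\<^bsub>M\<^esub> y) = f x \<oplus>\<^bsub>N\<^esub> f y"
    and "\<lbrakk>c \<in> carrier k; x \<in> carrier M\<rbrakk> \<Longrightarrow> f (c \<odot>\<^bsub>M\<^esub> x) = c \<odot>\<^bsub>N\<^esub> f x"
  using assms by (auto simp: linear_maps_def)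

lemma linear_maps_abelian_group_hom:
  assumes "f \<in> linear_maps k M N" "abelian_group M" "abelian_group N"
  shows "abelian_group_hom M N f"
proof (rule abelian_group_homI)
  show "group_hom (add_monoid M) (add_monoid N) f"
    using assms
    by (auto simp: group_hom_def group_hom_axioms_def hom_def linear_maps_def abelian_group.a_group)
qed (use assms in auto)

text \<open>\<open>linear_maps\<close> records only sums and scalars; zero and negatives follow
  because an additive map of abelian groups is a group homomorphism.\<close>

lemma linear_maps_compat:
  assumes "f \<in> linear_maps k M N" "abelian_group M" "abelian_group N"
  shows linear_maps_zero: "f \<zero>\<^bsub>M\<^esub> = \<zero>\<^bsub>N\<^esub>"
    and linear_maps_uminus: "x \<in> carrier M \<Longrightarrow> f (\<ominus>\<^bsub>M\<^esub> x) = \<ominus>\<^bsub>N\<^esub> f x"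
proof -
  interpret f: abelian_group_hom M N f
    by (rule linear_maps_abelian_group_hom[OF assms])
  show "f \<zero>\<^bsub>M\<^esub> = \<zero>\<^bsub>N\<^esub>" by (rule f.hom_zero)
  show "f (\<ominus>\<^bsub>M\<^esub> x) = \<ominus>\<^bsub>N\<^esub> f x" if "x \<in> carrier M"
    using that by (rule f.hom_a_inv)
qed

lemma linear_maps_comp:
  assumes "f \<in> linear_maps k L M" "g \<in> linear_maps k M N"
  shows "(\<lambda>x. g (f x)) \<in> linear_maps k L N"
  using assms by (auto simp: linear_maps_def Pi_iff)

lemma linear_maps_diff:
  assumes "module k N" "f \<in> linear_maps k M N" "g \<in> linear_maps k M N"
  shows "(\<lambda>x. f x \<ominus>\<^bsub>N\<^esub> g x) \<in> linear_maps k M N"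
proof -
  interpret N: module k N by fact
  note [simp] = linear_mapsD[OF assms(2)] linear_mapsD[OF assms(3)]
  show ?thesis
    unfolding linear_maps_def
    by (auto simp: a_minus_def N.smult_r_distr N.smult_r_minus N.minus_add N.a_ac)
qed

text \<open>Serves for the map \<open>h\<close> of the theorem, which is prescribed on the carrier
  only. The module structure of \<open>M\<close> keeps sums and scalar multiples inside the carrier,
  where \<open>g\<close> and \<open>f\<close> agree.\<close>

lemma linear_maps_cong:
  assumes "module k M" "f \<in> linear_maps k M N" "\<And>x. x \<in> carrier M \<Longrightarrow> g x = f x"
  shows "g \<in> linear_maps k M N"
proof -
  interpret M: module k M by fact
  show ?thesis
    using assms(2,3) by (auto simp: linear_maps_def)
qed

section \<open>Composition in a 2-module\<close>

context two_module
begin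

lemmas src_simps =
  linear_mapsD[OF src_linear]
  linear_maps_compat[OF src_linear Mor.abelian_group_axioms Obj.abelian_group_axioms]

lemmas tgt_simps =
  linear_mapsD[OF tgt_linear]
  linear_maps_compat[OF tgt_linear Mor.abelian_group_axioms Obj.abelian_group_axioms]

lemmas ident_simps =
  linear_mapsD[OF ident_linear]
  linear_maps_compat[OF ident_linear Obj.abelian_group_axioms Mor.abelian_group_axioms]

lemma ker_src_iff: "q \<in> ker_src A \<longleftrightarrow> q \<in> carrier (Mor A) \<and> src A q = \<zero>\<^bsub>Obj A\<^esub>"
  by (simp add: ker_src_def a_kernel_def')

lemma submodule_ker_src: "submodule (ker_src A) k (Mor A)"
  by (rule Mor.submoduleI) (auto simp: ker_src_iff src_simps)

text \<open>By linearity of \<open>ident A\<close>, the zero morphism is the identity morphism of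
  the zero object, which is the source of \<open>q\<close>; so this is the left unit law.\<close>

lemma zero_comp:
  assumes "q \<in> ker_src A"
  shows "comp2 A \<zero>\<^bsub>Mor A\<^esub> q = q"
  using ident_comp[of q] assms by (simp add: ker_src_iff ident_simps)

text \<open>In the fibre product, (a, b) is the sum of (a, e (t a)) and (0, b - e (t a)).
  Composition is additive there, and a unit law evaluates each summand.\<close>

lemma comp_eq:
  assumes a: "a \<in> carrier (Mor A)" and b: "b \<in> carrier (Mor A)" and ab: "tgt A a = src A b"
  shows "comp2 A a b = a \<oplus>\<^bsub>Mor A\<^esub> (b \<ominus>\<^bsub>Mor A\<^esub> ident A (tgt A a))"
proof -
  let ?e = "ident A (tgt A a)" and ?d = "b \<ominus>\<^bsub>Mor A\<^esub> ident A (tgt A a)"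
  \<comment> \<open>The difference has source zero because s b = t a = s (e (t a)).\<close>
  have e: "?e \<in> carrier (Mor A)" and d: "?d \<in> ker_src A"
    using a b ab
    by (auto simp: ker_src_iff ident_simps tgt_simps src_simps src_ident Mor.minus_closed
        a_minus_def Obj.r_neg)
  have "comp2 A (a \<oplus>\<^bsub>Mor A\<^esub> \<zero>\<^bsub>Mor A\<^esub>) (?e \<oplus>\<^bsub>Mor A\<^esub> ?d)
      = comp2 A a ?e \<oplus>\<^bsub>Mor A\<^esub> comp2 A \<zero>\<^bsub>Mor A\<^esub> ?d"
    using a e d by (intro comp_add) (auto simp: ker_src_iff src_ident tgt_simps)
  moreover have "?e \<oplus>\<^bsub>Mor A\<^esub> ?d = b"
    using b e by (simp add: a_minus_def Mor.a_lcomm[of ?e b] Mor.r_neg)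
  ultimately show ?thesis
    using a d by (simp add: comp_ident zero_comp)
qed

end

section \<open>The crossed module of a 2-algebra\<close>

context two_algebra
begin

text \<open>The kernel of the ring morphism s is an ideal; this gives both its own multiplication
  and the action by the elements e x.\<close>

lemma ker_src_mult:
  assumes "x \<in> carrier (Mor A)" "q \<in> ker_src A"
  shows "x \<otimes>\<^bsub>Mor A\<^esub> q \<in> ker_src A"
  using assms by (simp add: ker_src_iff src_mult src_simps)

lemma peiffer_identity:
  assumes c: "c \<in> ker_src A" and d: "d \<in> ker_src A"
  shows "ident A (tgt A c) \<otimes>\<^bsub>Mor A\<^esub> d = c \<otimes>\<^bsub>Mor A\<^esub> d"
proof -
  let ?e = "ident A (tgt A c)"
  have c': "c \<in> carrier (Mor A)" and e: "?e \<in> carrier (Mor A)"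
    using c by (auto simp: ker_src_iff tgt_simps ident_simps)
  \<comment> \<open>Since c \<bullet> 0 = 0, the left side is the composite of 0 with a kernel
    element, hence e (t c) \<bullet> d; the unit laws turn the right side into c \<bullet>
    d.\<close>
  have "comp2 A (c \<otimes>\<^bsub>Mor A\<^esub> \<zero>\<^bsub>Mor A\<^esub>) (?e \<otimes>\<^bsub>Mor A\<^esub> d)
      = comp2 A c ?e \<otimes>\<^bsub>Mor A\<^esub> comp2 A \<zero>\<^bsub>Mor A\<^esub> d"
    using c d e by (intro interchange) (auto simp: ker_src_iff src_ident tgt_simps)
  moreover have "comp2 A \<zero>\<^bsub>Mor A\<^esub> (?e \<otimes>\<^bsub>Mor A\<^esub> d) = ?e \<otimes>\<^bsub>Mor A\<^esub> d"
    by (intro zero_comp ker_src_mult e d)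
  ultimately show ?thesis
    using c' d by (simp add: comp_ident zero_comp)
qed

lemma nonunital_algebra_ker_src: "nonunital_algebra k ((Mor A)\<lparr>carrier := ker_src A\<rparr>)"
proof (rule nonunital_algebra.intro)
  show "module k ((Mor A)\<lparr>carrier := ker_src A\<rparr>)"
    by (rule submodule.submodule_is_module[OF submodule_ker_src Mor.module])
  show "nonunital_algebra_axioms k ((Mor A)\<lparr>carrier := ker_src A\<rparr>)"
    by unfold_locales
      (auto simp: ker_src_mult Mor.m_assoc Mor.l_distr Mor.smult_assoc2 ker_src_iff src_simps
        src_mult intro: Mor.m_comm)
qed

lemma nonunital_algebra_ker_src_over_Obj:
  "nonunital_algebra (Obj A) (xtop_over_base (Gamma A))"
proof -
  let ?C = "xtop_over_base (Gamma A)"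
  note defs = xtop_over_base_def Gamma_def
  have "abelian_group ?C"
  proof (rule abelian_groupI)
    show "\<exists>y\<in>carrier ?C. y \<oplus>\<^bsub>?C\<^esub> q = \<zero>\<^bsub>?C\<^esub>" if "q \<in> carrier ?C" for q
      using that
      by (intro bexI[of _ "\<ominus>\<^bsub>Mor A\<^esub> q"]) (auto simp: defs ker_src_iff src_simps Mor.l_neg)
  qed (auto simp: defs ker_src_iff src_simps Mor.a_ac)
  \<comment> \<open>A scalar x acts as multiplication by e x, so the module axioms are ring laws of
    \<open>Mor A\<close> pulled back along the ring morphism \<open>ident A\<close>. The reversed
    \<open>one_Mor\<close> handles the scalar 1.\<close>
  then have "module (Obj A) ?C"
    by (intro moduleI Obj.M_cring)
      (auto simp: defs ker_src_iff ident_simps src_simps src_mult src_ident Mor.l_distr Mor.r_distr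
        ident_mult Mor.m_assoc simp flip: one_Mor)
  then show ?thesis
    by (intro nonunital_algebra.intro nonunital_algebra_axioms.intro)
      (auto simp: defs ker_src_iff ident_simps src_simps src_mult Mor.l_distr Mor.m_assoc
        intro: Mor.m_comm)
qed

text \<open>Equivariance of the boundary comes from t being multiplicative with t e = id. The
  Peiffer identity is the one axiom that rests on composition.\<close>

lemma crossed_module_Gamma: "crossed_module k (Gamma A)"
proof (rule crossed_module.intro)
  show "algebra k (xbase (Gamma A))"
    by (simp add: Gamma_def Obj.algebra_axioms)
  show "nonunital_algebra k (xtop (Gamma A))"
    by (simp add: Gamma_def nonunital_algebra_ker_src)
  show "nonunital_algebra (xbase (Gamma A)) (xtop_over_base (Gamma A))"
    using nonunital_algebra_ker_src_over_Obj by (simp add: Gamma_def)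
  \<comment> \<open>The boundary is a \<open>restrict\<close>, equal to \<open>tgt A\<close> only on
    the kernel, so its linearity needs these memberships.\<close>
  have closed: "x \<oplus>\<^bsub>Mor A\<^esub> y \<in> ker_src A" "c \<odot>\<^bsub>Mor A\<^esub> x \<in> ker_src A"
    if "x \<in> ker_src A" "y \<in> ker_src A" "c \<in> carrier k" for x y c
    using that by (auto simp: ker_src_iff src_simps)
  show "crossed_module_axioms k (Gamma A)"
    by unfold_locales
      (auto simp: Gamma_def nonunital_alg_hom_def linear_maps_def closed ker_src_mult ident_simps
        ker_src_iff tgt_simps src_simps tgt_mult src_mult tgt_ident Mor.smult_assoc2
        peiffer_identity)
qed

end

section \<open>Action of \<open>Gamma\<close> on morphisms\<close>

lemma xmod_hom_Gamma:
  assumes "two_algebra_hom k A A' (F1, F0)"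
  shows "xmod_hom k (Gamma A) (Gamma A') (Gamma_hom A (F1, F0))"
proof -
  interpret A: two_algebra k A using assms by (simp add: two_algebra_hom_def)
  interpret A': two_algebra k A' using assms by (simp add: two_algebra_hom_def)
  have F1: "F1 \<in> nonunital_alg_hom k (Mor A) (Mor A')" and F0: "F0 \<in> alg_hom k (Obj A) (Obj A')"
    and st: "\<And>a. a \<in> carrier (Mor A) \<Longrightarrow> src A' (F1 a) = F0 (src A a)"
      "\<And>a. a \<in> carrier (Mor A) \<Longrightarrow> tgt A' (F1 a) = F0 (tgt A a)"
    and e: "\<And>x. x \<in> carrier (Obj A) \<Longrightarrow> ident A' (F0 x) = F1 (ident A x)"
    using assms by (auto simp: two_algebra_hom_def alg_hom_def)
  have F1_mult: "F1 (x \<otimes>\<^bsub>Mor A\<^esub> y) = F1 x \<otimes>\<^bsub>Mor A'\<^esub> F1 y"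
    if "x \<in> carrier (Mor A)" "y \<in> carrier (Mor A)" for x y
    using F1 that by (simp add: nonunital_alg_hom_def)
  have F1_lin: "F1 \<in> linear_maps k (Mor A) (Mor A')" and F0_lin: "F0 \<in> linear_maps k (Obj A) (Obj A')"
    using F1 F0 by (auto simp: nonunital_alg_hom_def alg_hom_def)
  have F0_zero: "F0 \<zero>\<^bsub>Obj A\<^esub> = \<zero>\<^bsub>Obj A'\<^esub>"
    by (rule linear_maps_zero[OF F0_lin A.Obj.abelian_group_axioms A'.Obj.abelian_group_axioms])
  \<comment> \<open>From s' F1 = F0 s and F0 0 = 0.\<close>
  have ker: "F1 q \<in> ker_src A'" if "q \<in> ker_src A" for q
    using that by (simp add: A.ker_src_iff A'.ker_src_iff st F0_zero linear_mapsD[OF F1_lin])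
  have "restrict F1 (ker_src A) \<in> nonunital_alg_hom k (xtop (Gamma A)) (xtop (Gamma A'))"
    by (auto simp: nonunital_alg_hom_def linear_maps_def Gamma_def ker F1_mult
        linear_mapsD[OF F1_lin] A.ker_src_mult A.ker_src_iff A.src_simps A.src_mult)
  then show ?thesis
    using F0 A.crossed_module_Gamma A'.crossed_module_Gamma
    by (auto simp: xmod_hom_def Gamma_hom_def Gamma_def ker A.ker_src_mult A.ident_simps st e
        F1_mult A.ker_src_iff A.src_mult A.src_ident)
qed

section \<open>From homotopies of 2-algebra morphisms to homotopies of crossed module
  morphisms\<close>

theorem theorem3p5:
  fixes k :: "('k, 'z) ring_scheme"
    and A :: "('k, 'a, 'b) two_struct"
    and A' :: "('k, 'c, 'd) two_struct"
    and F1 G1 :: "'b \<Rightarrow> 'd"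
    and F0 G0 :: "'a \<Rightarrow> 'c"
    and \<delta> h :: "'a \<Rightarrow> 'd"
  assumes "cring k"
    and "two_algebra k A"
    and "two_algebra k A'"
    and "two_algebra_hom k A A' (F1, F0)"
    and "two_algebra_hom k A A' (G1, G0)"
    and "two_algebra_homotopy k A A' (F1, F0) (G1, G0) \<delta>"
    and "\<And>x. x \<in> carrier (Obj A) \<Longrightarrow>
      h x = \<delta> x \<ominus>\<^bsub>Mor A'\<^esub> ident A' (src A' (\<delta> x))"
  shows "xmod_homotopy k (Gamma A) (Gamma A')
    (Gamma_hom A (F1, F0)) (Gamma_hom A (G1, G0)) (F0, h)"
proof -
  interpret A: two_algebra k A by fact
  interpret A': two_algebra k A' by fact
  have F: "F0 \<in> alg_hom k (Obj A) (Obj A')" "F1 \<in> linear_maps k (Mor A) (Mor A')"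
    "F0 \<in> linear_maps k (Obj A) (Obj A')"
    and tF: "\<And>a. a \<in> carrier (Mor A) \<Longrightarrow> tgt A' (F1 a) = F0 (tgt A a)"
    using assms(4) by (auto simp: two_algebra_hom_def alg_hom_def nonunital_alg_hom_def)
  have G: "G1 \<in> linear_maps k (Mor A) (Mor A')" "G0 \<in> linear_maps k (Obj A) (Obj A')"
    and sG: "\<And>a. a \<in> carrier (Mor A) \<Longrightarrow> src A' (G1 a) = G0 (src A a)"
    using assms(5) by (auto simp: two_algebra_hom_def alg_hom_def nonunital_alg_hom_def)
  have \<delta>_lin: "\<delta> \<in> linear_maps k (Obj A) (Mor A')"
    and \<delta>_mult: "\<And>x y. \<lbrakk>x \<in> carrier (Obj A); y \<in> carrier (Obj A)\<rbrakk> \<Longrightarrow>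
      \<delta> (x \<otimes>\<^bsub>Obj A\<^esub> y) = \<delta> x \<otimes>\<^bsub>Mor A'\<^esub> \<delta> y"
    and s\<delta>: "\<And>x. x \<in> carrier (Obj A) \<Longrightarrow> src A' (\<delta> x) = F0 x"
    and t\<delta>: "\<And>x. x \<in> carrier (Obj A) \<Longrightarrow> tgt A' (\<delta> x) = G0 x"
    and nat: "\<And>a. a \<in> carrier (Mor A) \<Longrightarrow>
      comp2 A' (F1 a) (\<delta> (tgt A a)) = comp2 A' (\<delta> (src A a)) (G1 a)"
    using assms(6) by (auto simp: two_algebra_homotopy_def alg_hom_def nonunital_alg_hom_def)
  note zeros =
    linear_maps_zero[OF \<delta>_lin A.Obj.abelian_group_axioms A'.Mor.abelian_group_axioms]
    linear_maps_zero[OF G(2) A.Obj.abelian_group_axioms A'.Obj.abelian_group_axioms]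
  note closed = linear_mapsD(1)[OF F(2)] linear_mapsD(1)[OF F(3)] linear_mapsD(1)[OF G(1)]
    linear_mapsD(1)[OF G(2)] linear_mapsD(1)[OF \<delta>_lin] A.tgt_simps(1) A'.ident_simps(1)
  \<comment> \<open>Replacing s' \<delta> by F0 exhibits \<open>h\<close> as a difference of two
    linear maps with the same source object at each x, which yields both its linearity and its
    values in the kernel.\<close>
  have h: "h x = \<delta> x \<ominus>\<^bsub>Mor A'\<^esub> ident A' (F0 x)" if "x \<in> carrier (Obj A)" for x
    using that by (simp add: assms(7) s\<delta>)
  have "(\<lambda>x. \<delta> x \<ominus>\<^bsub>Mor A'\<^esub> ident A' (F0 x)) \<in> linear_maps k (Obj A) (Mor A')"
    by (intro linear_maps_diff A'.Mor.module \<delta>_lin linear_maps_comp[OF F(3) A'.ident_linear])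
  then have h_lin: "h \<in> linear_maps k (Obj A) (Mor A')"
    by (rule linear_maps_cong[OF A.Obj.module]) (rule h)
  have h_ker: "h x \<in> ker_src A'" if "x \<in> carrier (Obj A)" for x
    using that
    by (simp add: A'.ker_src_iff h closed A'.Mor.minus_closed A'.src_simps A'.src_ident s\<delta>
        a_minus_def A'.Obj.r_neg)
  have \<delta>_eq: "\<delta> x = ident A' (F0 x) \<oplus>\<^bsub>Mor A'\<^esub> h x" if "x \<in> carrier (Obj A)" for x
    using that by (simp add: h closed a_minus_def A'.Mor.a_lcomm[of _ "\<delta> x"] A'.Mor.r_neg)
  have "xmod_derivation k (Obj A) (Gamma A') F0 h"
  proof -
    have "h (r \<otimes>\<^bsub>Obj A\<^esub> r') = ident A' (F0 r) \<otimes>\<^bsub>Mor A'\<^esub> h r'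
        \<oplus>\<^bsub>Mor A'\<^esub> ident A' (F0 r') \<otimes>\<^bsub>Mor A'\<^esub> h r \<oplus>\<^bsub>Mor A'\<^esub> h r \<otimes>\<^bsub>Mor A'\<^esub> h r'"
      if r: "r \<in> carrier (Obj A)" and r': "r' \<in> carrier (Obj A)" for r r'
    proof -
      let ?e = "ident A' (F0 r)" and ?e' = "ident A' (F0 r')"
      have c: "?e \<in> carrier (Mor A')" "?e' \<in> carrier (Mor A')" "h r \<in> carrier (Mor A')"
        "h r' \<in> carrier (Mor A')"
        using r r' h_lin by (auto simp: closed linear_mapsD)
      have rr': "r \<otimes>\<^bsub>Obj A\<^esub> r' \<in> carrier (Obj A)"
        using r r' A.Obj.M_cring by (simp add: cring_def ring_def monoid.m_closed)
      have "F0 (r \<otimes>\<^bsub>Obj A\<^esub> r') = F0 r \<otimes>\<^bsub>Obj A'\<^esub> F0 r'"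
        using F(1) r r' by (simp add: alg_hom_def nonunital_alg_hom_def)
      \<comment> \<open>Both \<delta> and e' F0 are multiplicative; the subtracted term cancels the
        pure identity part of the expanded product.\<close>
      then have "h (r \<otimes>\<^bsub>Obj A\<^esub> r') = (?e \<oplus>\<^bsub>Mor A'\<^esub> h r) \<otimes>\<^bsub>Mor A'\<^esub> (?e' \<oplus>\<^bsub>Mor A'\<^esub> h r')
          \<ominus>\<^bsub>Mor A'\<^esub> ?e \<otimes>\<^bsub>Mor A'\<^esub> ?e'"
        using r r' rr' by (simp add: h[OF rr'] \<delta>_mult \<delta>_eq[symmetric] A'.ident_mult closed)
      also have "\<dots> = ?e \<otimes>\<^bsub>Mor A'\<^esub> h r' \<oplus>\<^bsub>Mor A'\<^esub> ?e' \<otimes>\<^bsub>Mor A'\<^esub> h r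
          \<oplus>\<^bsub>Mor A'\<^esub> h r \<otimes>\<^bsub>Mor A'\<^esub> h r'"
        using c by algebra
      finally show ?thesis .
    qed
    \<comment> \<open>The kernel inherits its operations from \<open>Mor A'\<close>, so only the
      codomain changes.\<close>
    moreover have "h \<in> linear_maps k (Obj A) ((Mor A')\<lparr>carrier := ker_src A'\<rparr>)"
      using h_lin h_ker by (auto simp: linear_maps_def)
    ultimately show ?thesis
      using F(1) by (simp add: xmod_derivation_def Gamma_def)
  qed
  moreover have "G0 r = F0 r \<oplus>\<^bsub>Obj A'\<^esub> tgt A' (h r)" if "r \<in> carrier (Obj A)" for r
  proof -
    \<comment> \<open>This is t' \<delta> = G0 with \<delta> split into its identity part and
      \<open>h\<close>; then t' e' = id applies.\<close>
    have "G0 r = tgt A' (ident A' (F0 r) \<oplus>\<^bsub>Mor A'\<^esub> h r)"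
      using that by (simp add: \<delta>_eq[symmetric] t\<delta>)
    then show ?thesis
      using that h_lin by (simp add: A'.tgt_simps A'.tgt_ident closed linear_mapsD)
  qed
  moreover have "G1 c = F1 c \<oplus>\<^bsub>Mor A'\<^esub> h (tgt A c)" if "c \<in> ker_src A" for c
  proof -
    have c: "c \<in> carrier (Mor A)" "src A c = \<zero>\<^bsub>Obj A\<^esub>"
      using that by (auto simp: A.ker_src_iff)
    \<comment> \<open>As c has source zero, \<delta> (s c) = 0 and G1 c lies in the kernel of s', so
      \<open>zero_comp\<close> applies.\<close>
    have "G1 c = comp2 A' (\<delta> (src A c)) (G1 c)"
      using c by (simp add: zeros A'.zero_comp A'.ker_src_iff closed sG)
    also have "\<dots> = comp2 A' (F1 c) (\<delta> (tgt A c))"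
      using c by (simp add: nat)
    \<comment> \<open>Here t' (F1 c) = F0 (t c), so the bracket in \<open>comp_eq\<close> is exactly
      \<delta> (t c) - e' (F0 (t c)), the value of \<open>h\<close> at t c.\<close>
    also have "\<dots> = F1 c \<oplus>\<^bsub>Mor A'\<^esub> h (tgt A c)"
      using c by (simp add: A'.comp_eq closed s\<delta> tF h)
    finally show ?thesis .
  qed
  ultimately show ?thesis
    using xmod_hom_Gamma[OF assms(4)] xmod_hom_Gamma[OF assms(5)]
    by (auto simp: xmod_homotopy_def Gamma_hom_def Gamma_def h_ker A.ker_src_iff)
qed

end
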